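(* Let $P(x)=\sum_{k=0}^d a_kx^k$ be a real polynomial of degree $d\le 4$. Then the number of positive (respectively negative) roots of $P$ does not exceed the number of positive (respectively negative) essential tropical roots of $$tr_P^\dagger(\xi)=\max_{0\le k\le d}\left(k\xi+\ln|a_k|-k^2\right),\qquad \xi\in\mathbb{R}.$$
   Context: Terms with $a_k=0$ are ignored in the maximum. The tropical indices $k_0<k_1<\dots<k_m$ of $tr_P^\dagger$ are the integers $k\in\{0,\dots,d\}$ for which there is a real $x>0$ with $e^{-k^2}|a_k|x^k\ge\max_{i\ne k}e^{-i^2}|a_i|x^i$. The number of positive (resp. negative) essential tropical roots of $tr_P^\dagger$ is the number of sign alternations in the sequence $\{\mathrm{sgn}(a_{k_i})\}_{0\le i\le m}$ (resp. $\{\mathrm{sgn}((-1)^{k_i}a_{k_i})\}_{0\le i\le m}$). Real roots are counted with multiplicity. *)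

theory Defs
  imports "HOL-Analysis.Analysis" "HOL-Computational_Algebra.Polynomial"
begin

(* proots is the multiset of roots counted with multiplicity. *)
definition num_pos_roots :: "real poly \<Rightarrow> nat" where
  "num_pos_roots P = size (filter_mset (\<lambda>x. x > 0) (proots P))"

definition num_neg_roots :: "real poly \<Rightarrow> nat" where
  "num_neg_roots P = size (filter_mset (\<lambda>x. x < 0) (proots P))"

(* The tropical polynomial max (k * xi + ln |a_k| - k^2) over the k with a_k nonzero;
   used only through the lemma tropical_index_iff below, which relates it to the indices. *)
definition trop_dagger :: "real poly \<Rightarrow> real \<Rightarrow> real" where
  "trop_dagger P \<xi> =
     Max ((\<lambda>k. real k * \<xi> + ln \<bar>coeff P k\<bar> - (real k)\<^sup>2) ` {k. k \<le> degree P \<and> coeff P k \<noteq> 0})"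

(* The bounded quantifier over i says that the k-th term is at least the maximum of the other
   nonzero terms; it also covers monomials, where that maximum is over the empty set. *)
definition tropical_indices :: "real poly \<Rightarrow> nat set" where
  "tropical_indices P =
     {k. k \<le> degree P \<and>
         (\<exists>x>0. \<forall>i\<le>degree P. i \<noteq> k \<and> coeff P i \<noteq> 0 \<longrightarrow>
            exp (- ((real i)\<^sup>2)) * \<bar>coeff P i\<bar> * x ^ i
              \<le> exp (- ((real k)\<^sup>2)) * \<bar>coeff P k\<bar> * x ^ k)}"

definition sign_alternations :: "real list \<Rightarrow> nat" where
  "sign_alternations xs = card {i. Suc i < length xs \<and> xs ! i * xs ! Suc i < 0}"

definition num_pos_essential_roots :: "real poly \<Rightarrow> nat" where
  "num_pos_essential_roots P =
     sign_alternations (map (\<lambda>k. sgn (coeff P k)) (sorted_list_of_set (tropical_indices P)))"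

definition num_neg_essential_roots :: "real poly \<Rightarrow> nat" where
  "num_neg_essential_roots P =
     sign_alternations (map (\<lambda>k. sgn ((- 1) ^ k * coeff P k)) (sorted_list_of_set (tropical_indices P)))"

lemma finite_tropical_indices: "finite (tropical_indices P)"
  by (rule finite_subset[of _ "{..degree P}"]) (auto simp: tropical_indices_def)

lemma tropical_index_nonzero:
  assumes "P \<noteq> 0" "k \<in> tropical_indices P"
  shows "coeff P k \<noteq> 0"
proof
  assume 0: "coeff P k = 0"
  from assms(2) obtain x :: real where x: "x > 0" "\<And>i. i \<le> degree P \<Longrightarrow> i \<noteq> k \<Longrightarrow> coeff P i \<noteq> 0 \<Longrightarrow>
      exp (- ((real i)\<^sup>2)) * \<bar>coeff P i\<bar> * x ^ i \<le> exp (- ((real k)\<^sup>2)) * \<bar>coeff P k\<bar> * x ^ k"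
    by (auto simp: tropical_indices_def)
  have lc: "coeff P (degree P) \<noteq> 0" using assms(1) by simp
  with 0 have "degree P \<noteq> k" by auto
  from x(2)[OF order_refl this lc]
  have "exp (- ((real (degree P))\<^sup>2)) * \<bar>coeff P (degree P)\<bar> * x ^ degree P \<le> 0"
    using 0 by simp
  moreover have "exp (- ((real (degree P))\<^sup>2)) * \<bar>coeff P (degree P)\<bar> * x ^ degree P > 0"
    using lc x(1) by (intro mult_pos_pos) (auto simp del: leading_coeff_0_iff)
  ultimately show False by simp
qed

lemma exp_trop_term:
  fixes a \<xi> :: real
  assumes "a \<noteq> 0"
  shows "exp (- ((real k)\<^sup>2)) * \<bar>a\<bar> * exp \<xi> ^ k = exp (real k * \<xi> + ln \<bar>a\<bar> - (real k)\<^sup>2)"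
  using assms by (simp add: exp_diff exp_add exp_minus exp_of_nat2_mult field_simps)

lemma tropical_index_iff:
  assumes "P \<noteq> 0"
  shows "k \<in> tropical_indices P \<longleftrightarrow>
    coeff P k \<noteq> 0 \<and> (\<exists>\<xi>. trop_dagger P \<xi> = real k * \<xi> + ln \<bar>coeff P k\<bar> - (real k)\<^sup>2)"
proof (cases "coeff P k = 0")
  case True
  then show ?thesis using tropical_index_nonzero[OF assms] by auto
next
  case False
  then have k: "k \<le> degree P" by (rule le_degree)
  define t where "t \<xi> i = real i * \<xi> + ln \<bar>coeff P i\<bar> - (real i)\<^sup>2" for \<xi> i
  have "trop_dagger P \<xi> = t \<xi> k \<longleftrightarrow> (\<forall>i\<le>degree P. coeff P i \<noteq> 0 \<longrightarrow> t \<xi> i \<le> t \<xi> k)" for \<xi>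
    unfolding trop_dagger_def t_def[symmetric]
    using False k by (subst Max_eq_iff) auto
  moreover have "k \<in> tropical_indices P \<longleftrightarrow>
      (\<exists>\<xi>. \<forall>i\<le>degree P. coeff P i \<noteq> 0 \<longrightarrow> t \<xi> i \<le> t \<xi> k)"
  proof -
    have "k \<in> tropical_indices P \<longleftrightarrow> (\<exists>\<xi>. \<forall>i\<le>degree P. i \<noteq> k \<and> coeff P i \<noteq> 0 \<longrightarrow>
            exp (- ((real i)\<^sup>2)) * \<bar>coeff P i\<bar> * exp \<xi> ^ i
              \<le> exp (- ((real k)\<^sup>2)) * \<bar>coeff P k\<bar> * exp \<xi> ^ k)"
      unfolding tropical_indices_def using k by (simp) (metis exp_gt_zero exp_ln)
    also have "\<dots> \<longleftrightarrow> (\<exists>\<xi>. \<forall>i\<le>degree P. coeff P i \<noteq> 0 \<longrightarrow> t \<xi> i \<le> t \<xi> k)"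
      using exp_trop_term[OF False, of k] exp_trop_term by (simp add: t_def) (metis order_refl)
    finally show ?thesis .
  qed
  ultimately show ?thesis using False by (simp add: t_def)
qed

end

theory Submission
  imports Defs
begin

text \<open>
  Let \<open>T\<close> be the set of tropical indices of \<open>P = \<Sum> a\<^sub>k x\<^sup>k\<close>, let \<open>N\<close> be the number of positive
  roots and \<open>E\<close> the number of positive essential tropical roots. Replacing \<open>P(x)\<close> by \<open>P(-x)\<close>
  leaves \<open>T\<close> unchanged and exchanges positive and negative roots, as well as positive and
  negative essential tropical roots, so it suffices to show \<open>N \<le> E\<close>. Three facts give this in degree at most 4.

  \<^item> \<open>N\<close> and \<open>E\<close> have the same parity: the lowest and the highest exponent of \<open>P\<close> are both in
    \<open>T\<close>, and both parities are determined by the sign of the product of their coefficients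
    (\<open>essential_roots_parity\<close>).

  \<^item> If \<open>E \<le> 1\<close> then \<open>N \<le> 1\<close>. For every \<open>x > 0\<close> and every \<open>k\<close> there is \<open>i \<in> T\<close> with
    \<open>|a\<^sub>k| x\<^sup>k \<le> exp (- (i - k)\<^sup>2) |a\<^sub>i| x\<^sup>i\<close>: take the index at which the maximum over all terms is
    attained at the point \<open>x exp (2 k)\<close> (\<open>tropical_domination\<close>). So terms outside \<open>T\<close> are small
    everywhere on the positive axis. Since \<open>E \<le> 1\<close>, the coefficients with index in \<open>T\<close> change
    sign at most once, and for a suitable real \<open>c\<close> near the place of this change all the
    numbers \<open>(i - c) a\<^sub>i\<close> with \<open>i \<in> T\<close> have the same sign and together outweigh the other terms of
    \<open>x P'(x) - c P(x) = \<Sum> (k - c) a\<^sub>k x\<^sup>k\<close>. Hence this expression has no positive zero, the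
    function \<open>P(x) x powr (- c)\<close> is strictly monotone, and \<open>N \<le> 1\<close> by Rolle's theorem
    (\<open>num_pos_roots_le_1\<close>, \<open>weighted_sum_pos\<close>).

  \<^item> If \<open>N = 4\<close> then \<open>E = 4\<close>: the coefficients are elementary symmetric functions of positive
    numbers up to alternating signs, hence log-concave, and log-concavity puts every index in
    \<open>T\<close> (\<open>log_concave_tropical\<close>, \<open>num_pos_essential_roots_eq_4\<close>).

  If \<open>N > E\<close>, parity gives \<open>N \<ge> E + 2\<close>; as \<open>N \<le> 4\<close>, either \<open>E \<le> 1 < N\<close> or \<open>N = 4\<close> and \<open>E = 2\<close>,
  and both are excluded.
\<close>

section \<open>Sign alternations\<close>

lemma sign_alternations_short [simp]:
  "sign_alternations [] = 0" "sign_alternations [x] = 0"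
  by (simp_all add: sign_alternations_def)

lemma sign_alternations_Cons_Cons:
  "sign_alternations (x # y # xs) = (if x * y < 0 then 1 else 0) + sign_alternations (y # xs)"
proof -
  let ?A = "{i. Suc i < length (y # xs) \<and> (y # xs) ! i * (y # xs) ! Suc i < 0}"
  have fin: "finite ?A" by (rule finite_subset[of _ "{..length xs}"]) auto
  have "{i. Suc i < length (x # y # xs) \<and> (x # y # xs) ! i * (x # y # xs) ! Suc i < 0}
      = (if x * y < 0 then {0} else {}) \<union> Suc ` ?A" (is "?B = _")
  proof (rule set_eqI)
    fix i show "i \<in> ?B \<longleftrightarrow> i \<in> (if x * y < 0 then {0} else {}) \<union> Suc ` ?A"
      by (cases i) auto
  qed
  then show ?thesis
    unfolding sign_alternations_def using fin
    by (simp add: card_image card_insert_if)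
qed

lemma sign_alternations_parity:
  assumes "xs \<noteq> []" "\<forall>x\<in>set xs. x \<noteq> 0"
  shows "(- 1) ^ sign_alternations xs * (hd xs * last xs) > 0"
  using assms
proof (induction xs rule: induct_list012)
  case (3 x y zs)
  have IH: "(- 1) ^ sign_alternations (y # zs) * (y * last (y # zs)) > 0"
    using 3 by auto
  define u where "u = (- 1) ^ sign_alternations (y # zs) * last (y # zs)"
  have u: "u * y > 0" using IH by (simp add: u_def mult_ac)
  have "x \<noteq> 0" "y \<noteq> 0" using 3 by auto
  then have "(if x * y < 0 then - 1 else 1) * (u * x) > 0"
    using u by (auto simp: mult_less_0_iff zero_less_mult_iff)
  then show ?case
    by (auto simp: sign_alternations_Cons_Cons u_def mult_ac split: if_splits)
qed (auto simp: zero_less_mult_iff)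

lemma sign_alternations_eq_0D:
  assumes "sign_alternations (x # xs) = 0" "\<forall>y\<in>set (x # xs). y \<noteq> 0" "y \<in> set (x # xs)"
  shows "x * y > 0"
  using assms
proof (induction xs arbitrary: x)
  case (Cons z zs)
  have xz: "x * z > 0" and 0: "sign_alternations (z # zs) = 0"
    using Cons.prems(1,2) by (auto simp: sign_alternations_Cons_Cons zero_less_mult_iff
        not_less mult_less_0_iff linorder_neq_iff split: if_splits)
  show ?case
  proof (cases "y = x")
    case True
    with Cons.prems show ?thesis by (auto simp: zero_less_mult_iff)
  next
    case False
    with Cons.prems have "z * y > 0" by (intro Cons.IH[OF 0]) auto
    with xz show ?thesis by (auto simp: zero_less_mult_iff)
  qed
qed (auto simp: zero_less_mult_iff)

text \<open>
  With at most one alternation, the signs along \<open>ks\<close> are \<open>- s\<close> below a threshold \<open>m\<close> and \<open>s\<close> from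
  \<open>m\<close> on. The value \<open>m = 0\<close> covers the case of constant sign.
\<close>

lemma sign_alternations_le_1_threshold:
  fixes a :: "nat \<Rightarrow> real"
  assumes "sign_alternations (map (\<lambda>k. sgn (a k)) ks) \<le> 1" "sorted_wrt (<) ks"
    "\<forall>k\<in>set ks. a k \<noteq> 0"
  shows "\<exists>s m. s \<in> {- 1, 1} \<and> (m = 0 \<or> m \<in> set ks) \<and>
           (\<forall>k\<in>set ks. (if k < m then s * a k < 0 else s * a k > 0))"
  using assms
proof (induction ks rule: induct_list012)
  case 1
  show ?case by (intro exI[of _ 1] exI[of _ 0]) auto
next
  case (2 k)
  then show ?case
    by (intro exI[of _ "sgn (a k)"] exI[of _ 0]) (auto simp: sgn_if)
next
  case (3 k l ks)
  have nz: "a k \<noteq> 0" "a l \<noteq> 0" "\<forall>k\<in>set ks. a k \<noteq> 0" and kl: "k < l" "\<forall>i\<in>set ks. k < i \<and> l < i"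
    using "3.prems" by auto
  show ?case
  proof (cases "a k * a l < 0")
    case True
    then have "sgn (a k) * sgn (a l) < 0"
      by (auto simp: mult_less_0_iff)
    then have 0: "sign_alternations (sgn (a l) # map (\<lambda>k. sgn (a k)) ks) = 0"
      using "3.prems"(1) by (simp add: sign_alternations_Cons_Cons)
    have same: "sgn (a l) * sgn (a i) > 0" if "i \<in> set (l # ks)" for i
      using sign_alternations_eq_0D[OF 0, of "sgn (a i)"] nz that by (auto simp: sgn_eq_0_iff)
    have "sgn (a l) * a i > 0" if "i \<in> set (l # ks)" for i
      using same[OF that] by (simp add: zero_less_mult_iff)
    moreover have "sgn (a l) * a k < 0"
      using True by (auto simp: mult_less_0_iff sgn_if)
    moreover have "sgn (a l) \<in> {- 1, 1}" using nz by (simp add: sgn_if)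
    ultimately show ?thesis using kl
      by (intro exI[of _ "sgn (a l)"] exI[of _ l]) auto
  next
    case False
    then have pos: "a k * a l > 0"
      using nz by (auto simp: mult_less_0_iff zero_less_mult_iff not_less)
    have "sign_alternations (map (\<lambda>k. sgn (a k)) (l # ks)) \<le> 1"
      using "3.prems"(1) by (simp add: sign_alternations_Cons_Cons)
    then have "\<exists>s m. s \<in> {- 1, 1} \<and> (m = 0 \<or> m \<in> set (l # ks)) \<and>
        (\<forall>i\<in>set (l # ks). (if i < m then s * a i < 0 else s * a i > 0))"
      using "3.prems"(2,3) by (intro "3.IH"(2)) auto
    then obtain s m where sm: "s \<in> {- 1, 1}" "m = 0 \<or> m \<in> set (l # ks)"
      "\<forall>i\<in>set (l # ks). (if i < m then s * a i < 0 else s * a i > 0)"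
      by blast
    have sk: "s * a k > 0 \<longleftrightarrow> s * a l > 0" "s * a k < 0 \<longleftrightarrow> s * a l < 0"
      using pos by (auto simp: zero_less_mult_iff mult_less_0_iff)
    show ?thesis
    proof (cases "l < m")
      case True
      with sm(3) have "s * a l < 0" by simp
      with sk(2) have "s * a k < 0" by simp
      moreover have "k < m" using True kl by simp
      ultimately show ?thesis
        using sm by (intro exI[of _ s] exI[of _ m]) auto
    next
      case False
      have all: "s * a i > 0" if "i \<in> set (l # ks)" for i
      proof -
        have "\<not> i < m" using that kl False by auto
        with bspec[OF sm(3) that] show ?thesis by simp
      qed
      moreover have "s * a k > 0" using sk(1) all[of l] by simp
      ultimately show ?thesis
        using sm(1) by (intro exI[of _ s] exI[of _ 0]) auto
    qed
  qed
qed

section \<open>Positive roots\<close>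

lemma num_pos_roots_linear_factor:
  assumes "Q \<noteq> 0"
  shows "num_pos_roots ([:- r, 1:] * Q) = (if r > 0 then 1 else 0) + num_pos_roots Q"
  using assms unfolding num_pos_roots_def by (subst proots_mult) auto

lemma num_pos_roots_gt_0D:
  assumes "num_pos_roots P > 0"
  obtains r Q where "r > 0" "P = [:- r, 1:] * Q" "Q \<noteq> 0"
proof -
  have nz: "P \<noteq> 0" using assms by (auto simp: num_pos_roots_def)
  from assms obtain r where "r \<in># filter_mset (\<lambda>x. x > 0) (proots P)"
    unfolding num_pos_roots_def by (metis less_irrefl multiset_nonemptyE size_empty)
  then have "r > 0" "poly P r = 0" using nz by auto
  then obtain Q where "P = [:- r, 1:] * Q" unfolding poly_eq_0_iff_dvd dvd_def by blast
  moreover from this nz have "Q \<noteq> 0" by auto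
  ultimately show ?thesis using \<open>r > 0\<close> that by blast
qed

lemma num_pos_roots_eq_0D:
  assumes "P \<noteq> 0" "num_pos_roots P = 0" "x > 0"
  shows "poly P x \<noteq> 0"
proof
  assume "poly P x = 0"
  then have "x \<in># filter_mset (\<lambda>x. x > 0) (proots P)" using assms by simp
  with assms(2) show False by (auto simp: num_pos_roots_def)
qed

lemma num_pos_roots_le_degree: "num_pos_roots P \<le> degree P"
  unfolding num_pos_roots_def
  by (meson size_filter_mset_lesseq size_proots_le order_trans)

text \<open>Equality holds as well, but only this inequality is needed.\<close>

lemma num_neg_roots_le_reflect:
  "num_neg_roots P \<le> num_pos_roots (pcompose P [:0, - 1:])"
proof (induction "num_neg_roots P" arbitrary: P)
  case (Suc n)
  have nz: "P \<noteq> 0" using Suc(2) by (auto simp: num_neg_roots_def)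
  from Suc(2) obtain r where "r \<in># filter_mset (\<lambda>x. x < 0) (proots P)"
    unfolding num_neg_roots_def by (metis nat.distinct(1) multiset_nonemptyE size_empty)
  then have r: "r < 0" "poly P r = 0" using nz by auto
  then obtain Q where Q: "P = [:- r, 1:] * Q" by (auto simp: poly_eq_0_iff_dvd dvd_def)
  with nz have Q0: "Q \<noteq> 0" by auto
  have "num_neg_roots P = Suc (num_neg_roots Q)"
    unfolding Q num_neg_roots_def using r Q0 by (subst proots_mult) auto
  moreover have "pcompose P [:0, - 1:] = - ([:- (- r), 1:] * pcompose Q [:0, - 1:])"
    unfolding Q by (simp add: pcompose_mult pcompose_pCons pcompose_1 del: mult_pCons_left) simp
  then have "num_pos_roots (pcompose P [:0, - 1:]) =
      num_pos_roots ([:- (- r), 1:] * pcompose Q [:0, - 1:])"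
    by (simp only: num_pos_roots_def proots_uminus)
  then have "num_pos_roots (pcompose P [:0, - 1:]) = Suc (num_pos_roots (pcompose Q [:0, - 1:]))"
    using r Q0 by (subst (asm) num_pos_roots_linear_factor) (auto simp: pcompose_eq_0_iff)
  ultimately show ?case using Suc by simp
qed simp

text \<open>
  Splitting off a factor \<open>x - r\<close> with \<open>r > 0\<close> reverses the sign of the constant coefficient and
  keeps the leading one; without positive roots the two agree in sign by the intermediate
  value theorem.
\<close>

lemma num_pos_roots_parity_constant_coeff:
  assumes "poly P 0 \<noteq> 0"
  shows "(- 1) ^ num_pos_roots P * (poly P 0 * lead_coeff P) > 0"
  using assms
proof (induction "num_pos_roots P" arbitrary: P)
  case 0
  have nz: "P \<noteq> 0" using 0 by auto
  have "poly Q 0 > 0" if Q: "Q \<noteq> 0" "lead_coeff Q > 0" "num_pos_roots Q = 0" "poly Q 0 \<noteq> 0" for Q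
  proof (rule ccontr)
    assume "\<not> poly Q 0 > 0"
    with Q have neg: "poly Q 0 < 0" by simp
    obtain b where b: "\<And>x. x \<ge> b \<Longrightarrow> poly Q x \<ge> lead_coeff Q"
      using poly_pinfty_gt_lc[OF Q(2)] by blast
    have "poly Q (max b 1) > 0" using b[of "max b 1"] Q(2) by simp
    from poly_IVT_pos[OF _ neg this] obtain x where "x > 0" "poly Q x = 0"
      by (meson less_max_iff_disj zero_less_one)
    with num_pos_roots_eq_0D[OF Q(1,3)] show False by blast
  qed
  note * = this
  have "lead_coeff P \<noteq> 0" using nz by simp
  then consider "lead_coeff P > 0" | "lead_coeff (- P) > 0" by (force simp: lead_coeff_minus)
  then show ?case
  proof cases
    case 1
    then show ?thesis using *[OF nz 1] 0 by simp
  next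
    case 2
    moreover have "num_pos_roots (- P) = 0" using 0 by (simp add: num_pos_roots_def)
    ultimately have "poly (- P) 0 > 0" using nz 0 by (intro *) auto
    then show ?thesis using 2 0 by (simp add: mult_neg_neg)
  qed
next
  case (Suc n)
  obtain r Q where rQ: "r > 0" "P = [:- r, 1:] * Q" "Q \<noteq> 0"
    using num_pos_roots_gt_0D[of P] Suc(2) by (metis zero_less_Suc)
  have n: "num_pos_roots P = Suc (num_pos_roots Q)"
    using num_pos_roots_linear_factor[OF rQ(3), of r] rQ by simp
  have "poly Q 0 \<noteq> 0" using Suc(3) rQ by auto
  then have "r * ((- 1) ^ num_pos_roots Q * (poly Q 0 * lead_coeff Q)) > 0"
    using Suc(1)[of Q] Suc(2) n rQ(1) by simp
  moreover have "lead_coeff P = lead_coeff Q"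
    unfolding rQ(2) by (subst lead_coeff_mult) simp
  moreover have "poly P 0 = - r * poly Q 0" using rQ by simp
  ultimately show ?case by (simp add: n mult_ac)
qed

lemma num_pos_roots_parity:
  assumes "P \<noteq> 0" "coeff P n \<noteq> 0" "\<And>j. j < n \<Longrightarrow> coeff P j = 0"
  shows "(- 1) ^ num_pos_roots P * (coeff P n * lead_coeff P) > 0"
proof -
  have "monom 1 n dvd P"
    unfolding monom_1_dvd_iff' using assms(3) by blast
  then obtain Q where Q: "P = monom 1 n * Q" by (auto simp: dvd_def)
  have Q0: "Q \<noteq> 0" using Q assms(1) by auto
  have c: "coeff P n = poly Q 0" unfolding Q by (simp add: coeff_monom_mult poly_0_coeff_0)
  have "filter_mset (\<lambda>x. x > 0) (proots (monom 1 n :: real poly)) = {#}"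
    by (auto simp: filter_mset_eq_conv poly_monom)
  then have "num_pos_roots P = num_pos_roots Q"
    unfolding Q num_pos_roots_def using Q0 by (subst proots_mult) auto
  moreover have "lead_coeff P = lead_coeff Q"
    unfolding Q by (subst lead_coeff_mult) (simp add: degree_monom_eq)
  ultimately show ?thesis using num_pos_roots_parity_constant_coeff[of Q] assms(2) c by simp
qed

text \<open>
  The quantity \<open>x P'(x) - c P(x)\<close> is the derivative of \<open>P(x) x powr (- c)\<close> up to a positive
  factor. So if it never vanishes, then \<open>P\<close> has no multiple positive root, and by the mean value
  theorem it has no two distinct ones.
\<close>

lemma num_pos_roots_le_1:
  assumes ne: "\<And>x. x > 0 \<Longrightarrow> x * poly (pderiv P) x - c * poly P x \<noteq> 0"
  shows "num_pos_roots P \<le> 1"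
proof (rule ccontr)
  assume "\<not> ?thesis"
  then have N: "num_pos_roots P > 1" by simp
  then obtain r Q where rQ: "r > 0" "P = [:- r, 1:] * Q" "Q \<noteq> 0"
    using num_pos_roots_gt_0D[of P] by (metis less_trans zero_less_one)
  then have "num_pos_roots Q > 0"
    using N num_pos_roots_linear_factor[of Q r] by simp
  then obtain t Q' where t: "t > 0" "Q = [:- t, 1:] * Q'" by (rule num_pos_roots_gt_0D)
  have 0: "poly P r = 0" "poly P t = 0" using rQ t by auto
  show False
  proof (cases "r = t")
    case True
    then have "poly (pderiv P) r = 0"
      unfolding rQ(2) t(2) by (simp add: pderiv_mult pderiv_pCons del: mult_pCons_left)
    then show False using ne[OF rQ(1)] 0 by simp
  next
    case False
    define f where "f x = poly P x * x powr - c" for x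
    have f': "(f has_real_derivative (x * poly (pderiv P) x - c * poly P x) * x powr (- c - 1)) (at x)"
      if "x > 0" for x
    proof -
      have "x powr - c = x * x powr (- c - 1)"
        using that by (simp add: powr_diff)
      then show ?thesis unfolding f_def using that
        by (auto intro!: derivative_eq_intros simp: algebra_simps)
    qed
    have "False" if uv: "0 < u" "u < v" "poly P u = 0" "poly P v = 0" for u v
    proof -
      have d: "(f has_real_derivative (x * poly (pderiv P) x - c * poly P x) * x powr (- c - 1)) (at x)"
        if "u \<le> x" for x using f'[of x] that \<open>0 < u\<close> by simp
      have "\<exists>z>u. z < v \<and> f v - f u = (v - u) * ((z * poly (pderiv P) z - c * poly P z) * z powr (- c - 1))"
        by (rule MVT2) (use uv d in auto)
      then obtain z where z: "z > u" "(v - u) * ((z * poly (pderiv P) z - c * poly P z) * z powr (- c - 1)) = 0"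
        using uv(3,4) unfolding f_def by auto
      with ne[of z] uv show False by auto
    qed
    then show False using False rQ(1) t(1) 0 by (metis linorder_neqE)
  qed
qed

section \<open>Tropical indices\<close>

lemma tropical_index_attained:
  assumes "x > 0"
  shows "\<exists>i\<in>tropical_indices P. \<forall>j\<le>degree P.
     exp (- ((real j)\<^sup>2)) * \<bar>coeff P j\<bar> * x ^ j \<le> exp (- ((real i)\<^sup>2)) * \<bar>coeff P i\<bar> * x ^ i"
proof -
  let ?b = "\<lambda>j. exp (- ((real j)\<^sup>2)) * \<bar>coeff P j\<bar> * x ^ j"
  have "Max (?b ` {..degree P}) \<in> ?b ` {..degree P}" by (rule Max_in) auto
  then obtain i where "i \<in> {..degree P}" "?b i = Max (?b ` {..degree P})"
    by (metis (no_types, lifting) imageE)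
  then have i: "i \<le> degree P" "?b i = Max (?b ` {..degree P})" by auto
  have "?b j \<le> ?b i" if "j \<le> degree P" for j
    unfolding i(2) using that by (intro Max_ge) auto
  with i(1) assms show ?thesis unfolding tropical_indices_def by blast
qed

text \<open>
  Multiplying \<open>x\<close> by \<open>exp (2 k)\<close> turns the weights \<open>exp (- j\<^sup>2)\<close> into \<open>exp (- (j - k)\<^sup>2)\<close>, up to the
  common factor \<open>exp (k\<^sup>2)\<close>. At this point the weight of the \<open>k\<close>-th term is the largest one.
\<close>

lemma tropical_domination:
  assumes "x > 0"
  shows "\<exists>i\<in>tropical_indices P.
     \<bar>coeff P k\<bar> * x ^ k \<le> exp (- ((real i - real k)\<^sup>2)) * (\<bar>coeff P i\<bar> * x ^ i)"
proof -
  have e: "exp (- ((real j)\<^sup>2)) * \<bar>coeff P j\<bar> * (x * exp (2 * real k)) ^ j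
      = exp ((real k)\<^sup>2) * (exp (- ((real j - real k)\<^sup>2)) * (\<bar>coeff P j\<bar> * x ^ j))" for j
  proof -
    have "exp (- ((real j)\<^sup>2)) * exp (2 * real k) ^ j = exp ((real k)\<^sup>2) * exp (- ((real j - real k)\<^sup>2))"
      unfolding exp_of_nat_mult[symmetric] exp_add[symmetric]
      by (simp add: power2_eq_square algebra_simps)
    then show ?thesis by (simp add: power_mult_distrib mult_ac)
  qed
  obtain i where i: "i \<in> tropical_indices P" "\<And>j. j \<le> degree P \<Longrightarrow>
      exp (- ((real j)\<^sup>2)) * \<bar>coeff P j\<bar> * (x * exp (2 * real k)) ^ j
      \<le> exp (- ((real i)\<^sup>2)) * \<bar>coeff P i\<bar> * (x * exp (2 * real k)) ^ i"
    using tropical_index_attained[of "x * exp (2 * real k)" P] assms by auto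
  show ?thesis
  proof (cases "k \<le> degree P")
    case True
    from i(2)[OF True] have "\<bar>coeff P k\<bar> * x ^ k
        \<le> exp (- ((real i - real k)\<^sup>2)) * (\<bar>coeff P i\<bar> * x ^ i)"
      unfolding e by simp
    with i(1) show ?thesis by blast
  next
    case False
    then have "coeff P k = 0" by (simp add: coeff_eq_0)
    with i(1) assms show ?thesis by (intro bexI[of _ i]) auto
  qed
qed

lemma tropical_domination_weak:
  assumes "x > 0"
  shows "\<exists>i\<in>tropical_indices P. \<bar>coeff P k\<bar> * x ^ k \<le> \<bar>coeff P i\<bar> * x ^ i"
proof -
  obtain i where i: "i \<in> tropical_indices P"
     "\<bar>coeff P k\<bar> * x ^ k \<le> exp (- ((real i - real k)\<^sup>2)) * (\<bar>coeff P i\<bar> * x ^ i)"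
    using tropical_domination[OF assms] by blast
  note i(2)
  also have "\<dots> \<le> 1 * (\<bar>coeff P i\<bar> * x ^ i)"
    using assms by (intro mult_right_mono) auto
  finally show ?thesis using i(1) by auto
qed

lemma lowest_index_tropical:
  assumes "P \<noteq> 0" "coeff P n \<noteq> 0" "\<And>j. j < n \<Longrightarrow> coeff P j = 0"
  shows "n \<in> tropical_indices P"
proof (rule ccontr)
  assume n: "n \<notin> tropical_indices P"
  define M where "M = (\<Sum>i\<le>degree P. \<bar>coeff P i\<bar>)"
  have M: "\<bar>coeff P i\<bar> \<le> M" for i
    unfolding M_def by (cases "i \<le> degree P") (auto intro!: member_le_sum sum_nonneg simp: coeff_eq_0)
  \<comment> \<open>so small that every term of higher degree is less than the \<open>n\<close>-th one\<close>
  define x where "x = \<bar>coeff P n\<bar> / (2 * M)"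
  have M0: "M > 0" using M[of n] assms(2) by linarith
  have x: "x > 0" "x \<le> 1" and Mx: "M * x = \<bar>coeff P n\<bar> / 2"
    using M0 M[of n] assms(2) by (auto simp: x_def field_simps)
  obtain i where i: "i \<in> tropical_indices P" "\<bar>coeff P n\<bar> * x ^ n \<le> \<bar>coeff P i\<bar> * x ^ i"
    using tropical_domination_weak[OF x(1)] by blast
  have "i > n"
    using tropical_index_nonzero[OF assms(1) i(1)] assms(3)[of i] n i(1) by (metis linorder_neqE_nat)
  then have "\<bar>coeff P i\<bar> * x ^ i \<le> M * x ^ Suc n"
    using M[of i] M0 x by (intro mult_mono power_decreasing) auto
  also have "\<dots> = (\<bar>coeff P n\<bar> / 2) * x ^ n" by (simp add: Mx[symmetric])
  also have "\<dots> < \<bar>coeff P n\<bar> * x ^ n" using x assms(2) by simp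
  finally show False using i(2) by simp
qed

lemma degree_tropical:
  assumes "P \<noteq> 0"
  shows "degree P \<in> tropical_indices P"
proof (rule ccontr)
  let ?d = "degree P"
  assume n: "?d \<notin> tropical_indices P"
  define M where "M = (\<Sum>i\<le>degree P. \<bar>coeff P i\<bar>)"
  have M: "\<bar>coeff P i\<bar> \<le> M" for i
    unfolding M_def by (cases "i \<le> degree P") (auto intro!: member_le_sum sum_nonneg simp: coeff_eq_0)
  have l: "\<bar>lead_coeff P\<bar> > 0" using assms by simp
  \<comment> \<open>so large that every term of lower degree is less than the leading one\<close>
  define x where "x = 2 * M / \<bar>lead_coeff P\<bar>"
  have M0: "M > 0" using M[of ?d] l by linarith
  have x: "x \<ge> 1" and Mx: "M = \<bar>lead_coeff P\<bar> * x / 2"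
    using M0 M[of ?d] l by (auto simp: x_def field_simps simp del: leading_coeff_0_iff)
  obtain i where i: "i \<in> tropical_indices P" "\<bar>lead_coeff P\<bar> * x ^ ?d \<le> \<bar>coeff P i\<bar> * x ^ i"
    using tropical_domination_weak[of x P ?d] x by auto
  have "i < ?d"
    using i(1) n by (auto simp: tropical_indices_def order.strict_iff_order)
  then obtain e where e: "?d = Suc e" "i \<le> e" by (cases ?d) auto
  then have "\<bar>coeff P i\<bar> * x ^ i \<le> M * x ^ e"
    using M[of i] M0 x by (intro mult_mono power_increasing) auto
  also have "\<dots> = (\<bar>lead_coeff P\<bar> / 2) * x ^ ?d"
    unfolding e(1) power_Suc by (subst Mx) (simp add: e(1))
  also have "\<dots> < \<bar>lead_coeff P\<bar> * x ^ ?d" using x l by simp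
  finally show False using i(2) by simp
qed

lemma essential_roots_parity:
  assumes "P \<noteq> 0"
  shows "even (num_pos_roots P + num_pos_essential_roots P)"
proof -
  define n where "n = (LEAST n. coeff P n \<noteq> 0)"
  have n: "coeff P n \<noteq> 0" "\<And>j. j < n \<Longrightarrow> coeff P j = 0"
    using LeastI[of "\<lambda>n. coeff P n \<noteq> 0" "degree P"] assms not_less_Least
    unfolding n_def by auto
  let ?T = "tropical_indices P"
  let ?ks = "sorted_list_of_set ?T"
  let ?xs = "map (\<lambda>k. sgn (coeff P k)) ?ks"
  have fin: "finite ?T" by (rule finite_tropical_indices)
  have nT: "n \<in> ?T" using lowest_index_tropical[OF assms] n by blast
  have dT: "degree P \<in> ?T" using degree_tropical[OF assms] .
  have ne: "?ks \<noteq> []" using fin nT by auto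
  have "Min ?T = n"
    using fin nT tropical_index_nonzero[OF assms] n(2) by (intro Min_eqI) (auto simp: not_less[symmetric])
  then have hd: "hd ?ks = n"
    using fin nT by (subst sorted_list_of_set_nonempty) auto
  have "last ?ks \<in> ?T" using ne fin last_in_set[OF ne] by simp
  moreover have "degree P \<le> last ?ks"
  proof -
    have "\<exists>ys. ?ks = ys @ [last ?ks]" using ne by (metis append_butlast_last_id)
    then obtain ys z where ys: "?ks = ys @ [z]" "z = last ?ks" by blast
    have "sorted (ys @ [z])" unfolding ys(1)[symmetric] by simp
    moreover have "degree P \<in> set (ys @ [z])" unfolding ys(1)[symmetric] using dT fin by simp
    ultimately show ?thesis unfolding ys(2)[symmetric] by (auto simp: sorted_append)
  qed
  ultimately have la: "last ?ks = degree P"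
    by (auto simp: tropical_indices_def)
  have "\<forall>x\<in>set ?xs. x \<noteq> 0"
    using fin tropical_index_nonzero[OF assms] by (auto simp: sgn_eq_0_iff)
  from sign_alternations_parity[OF _ this] have
    "(- 1) ^ num_pos_essential_roots P * (sgn (coeff P n) * sgn (lead_coeff P)) > 0"
    using ne by (simp add: num_pos_essential_roots_def hd_map last_map hd la)
  moreover have "(- 1) ^ num_pos_roots P * (coeff P n * lead_coeff P) > 0"
    using num_pos_roots_parity[OF assms] n by blast
  ultimately show ?thesis
    by (cases "even (num_pos_roots P)"; cases "even (num_pos_essential_roots P)")
      (auto simp: zero_less_mult_iff mult_less_0_iff sgn_if split: if_splits)
qed


section \<open>At most one sign alternation\<close>

text \<open>
  Rational upper bounds for the weights \<open>exp (- d\<^sup>2)\<close> that occur at distance \<open>d = 1, 2, 3\<close>. They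
  follow from \<open>exp 1 \<ge> 1 + 1 + 1/2 + 1/6 = 8/3\<close>.
\<close>

lemma exp_minus_bounds:
  "exp (- 1) \<le> (3 / 8 :: real)" "exp (- 4) \<le> (1 / 50 :: real)" "exp (- 9) \<le> (1 / 1000 :: real)"
proof -
  have "(\<Sum>n<4. (1::real) ^ n /\<^sub>R fact n) \<le> exp 1"
    unfolding exp_def by (intro sum_le_suminf summable_exp_generic) auto
  then have e: "8 / 3 \<le> exp (1::real)"
    by (simp add: numeral_eq_Suc fact_numeral lessThan_Suc)
  then show "exp (- 1) \<le> (3 / 8 :: real)" by (simp add: exp_minus field_simps)
  have p: "(8 / 3) ^ n \<le> exp (real n)" for n
    using power_mono[OF e, of n] by (simp add: exp_of_nat_mult[symmetric])
  show "exp (- 4) \<le> (1 / 50 :: real)" using p[of 4] by (simp add: exp_minus field_simps)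
  show "exp (- 9) \<le> (1 / 1000 :: real)" using p[of 9] by (simp add: exp_minus field_simps)
qed

text \<open>
  The linear arithmetic behind the case \<open>E \<le> 1\<close>. Here \<open>t\<^sub>k\<close> stands for \<open>s a\<^sub>k x\<^sup>k\<close> and \<open>b\<^sub>k\<close> for
  \<open>k \<in> T\<close>, while \<open>z\<^sub>k\<close> is \<open>|t\<^sub>k|\<close> if \<open>k \<in> T\<close> and \<open>0\<close> otherwise. In \<open>T\<close>, the sign of \<open>t\<^sub>k\<close> is negative
  exactly below the threshold \<open>m\<close>; outside \<open>T\<close>, the term \<open>t\<^sub>k\<close> is bounded by the \<open>z\<^sub>i\<close>, and it
  vanishes for \<open>k = 0\<close> and \<open>k = 4\<close>.

  The number \<open>c\<close> depends only on \<open>m\<close> and \<open>T\<close>, not on \<open>x\<close>. It lies strictly between the last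
  index \<open>l < m\<close> in \<open>T\<close>, if there is one, and \<open>m\<close>. For \<open>l = m - 1\<close> the midpoint would make the
  weight \<open>|k - c|\<close> of a term outside \<open>T\<close> three times that of its neighbour in \<open>T\<close>, too much for
  the bound \<open>3/8\<close>; therefore \<open>c\<close> is moved towards \<open>l\<close> or \<open>m\<close>, whichever is closer to an end of
  \<open>{0..4}\<close>. For \<open>m = 0\<close>, where no sign change occurs, \<open>c = - 1\<close> keeps all weights positive.
\<close>

lemma weighted_sum_pos:
  fixes t0 t1 t2 t3 t4 z0 z1 z2 z3 z4 c :: real and m :: nat
  assumes "if b0 then z0 > 0 \<and> t0 = (if 0 < m then - z0 else z0) else z0 = 0 \<and> t0 = 0"
    and "if b1 then z1 > 0 \<and> t1 = (if 1 < m then - z1 else z1)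
         else z1 = 0 \<and> \<bar>t1\<bar> \<le> 3/8 * z0 + 3/8 * z2 + 1/50 * z3 + 1/1000 * z4"
    and "if b2 then z2 > 0 \<and> t2 = (if 2 < m then - z2 else z2)
         else z2 = 0 \<and> \<bar>t2\<bar> \<le> 1/50 * z0 + 3/8 * z1 + 3/8 * z3 + 1/50 * z4"
    and "if b3 then z3 > 0 \<and> t3 = (if 3 < m then - z3 else z3)
         else z3 = 0 \<and> \<bar>t3\<bar> \<le> 1/1000 * z0 + 1/50 * z1 + 3/8 * z2 + 3/8 * z4"
    and "if b4 then z4 > 0 \<and> t4 = (if 4 < m then - z4 else z4) else z4 = 0 \<and> t4 = 0"
    and "b0 \<or> b1 \<or> b2 \<or> b3 \<or> b4"
    and m: "m = 0 \<or> m = 1 \<and> b1 \<or> m = 2 \<and> b2 \<or> m = 3 \<and> b3 \<or> m = 4 \<and> b4"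
    and c: "c = (if m = 0 then - 1 else if m = 1 then 1/5
       else if m = 2 then (if b1 then 6/5 else 1)
       else if m = 3 then (if b2 then 14/5 else if b1 then 2 else 1)
       else if b3 then 19/5 else if b2 \<or> b1 then 3 else 2)"
  shows "- c * t0 + (1 - c) * t1 + (2 - c) * t2 + (3 - c) * t3 + (4 - c) * t4 > 0"
  using m
proof (elim disjE conjE)
  assume m: "m = 0"
  show ?thesis using assms(1-6) unfolding c using m
    by (cases b0; cases b1; cases b2; cases b3; cases b4; simp add: abs_le_iff; linarith?)
next
  assume m: "m = 1" b1
  show ?thesis using assms(1-6) unfolding c using m
    by (cases b0; cases b2; cases b3; cases b4; simp add: abs_le_iff; linarith?)
next
  assume m: "m = 2" b2
  show ?thesis using assms(1-6) unfolding c using m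
    by (cases b0; cases b1; cases b3; cases b4; simp add: abs_le_iff; linarith?)
next
  assume m: "m = 3" b3
  show ?thesis using assms(1-6) unfolding c using m
    by (cases b0; cases b1; cases b2; cases b4; simp add: abs_le_iff; linarith?)
next
  assume m: "m = 4" b4
  show ?thesis using assms(1-6) unfolding c using m
    by (cases b0; cases b1; cases b2; cases b3; simp add: abs_le_iff; linarith?)
qed

lemma poly_eq_pCons5:
  assumes "degree P \<le> 4"
  shows "P = [:coeff P 0, coeff P 1, coeff P 2, coeff P 3, coeff P 4:]"
proof (rule poly_eqI)
  fix n :: nat
  have "n = 0 \<or> n = 1 \<or> n = 2 \<or> n = 3 \<or> n = 4 \<or> n > 4" by arith
  then show "coeff P n = coeff [:coeff P 0, coeff P 1, coeff P 2, coeff P 3, coeff P 4:] n"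
    using assms by (elim disjE) (auto simp: numeral_eq_Suc coeff_eq_0 coeff_pCons split: nat.splits)
qed

text \<open>
  The sum on the right replaces the unknown dominating index of \<open>tropical_domination\<close>; the index
  \<open>k\<close> itself contributes nothing to it.
\<close>

lemma hidden_term_bound:
  assumes "x > 0" "k \<notin> tropical_indices P" "degree P \<le> 4"
  defines "z \<equiv> \<lambda>i. if i \<in> tropical_indices P then \<bar>coeff P i\<bar> * x ^ i else 0"
  shows "\<bar>coeff P k\<bar> * x ^ k \<le> (\<Sum>i\<le>4. exp (- ((real i - real k)\<^sup>2)) * z i)"
proof -
  obtain i where i: "i \<in> tropical_indices P"
    "\<bar>coeff P k\<bar> * x ^ k \<le> exp (- ((real i - real k)\<^sup>2)) * (\<bar>coeff P i\<bar> * x ^ i)"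
    using tropical_domination[OF assms(1)] by blast
  have "i \<le> 4" using i(1) assms(3) by (auto simp: tropical_indices_def)
  then have "exp (- ((real i - real k)\<^sup>2)) * z i \<le> (\<Sum>i\<le>4. exp (- ((real i - real k)\<^sup>2)) * z i)"
    using assms(1) by (intro member_le_sum) (auto simp: z_def)
  with i show ?thesis by (simp add: z_def)
qed

lemma num_pos_roots_le_1_if_threshold:
  assumes "P \<noteq> 0" "degree P \<le> 4" "s \<in> {- 1, 1::real}" "m = 0 \<or> m \<in> tropical_indices P"
    "\<forall>k\<in>tropical_indices P. (if k < m then s * coeff P k < 0 else s * coeff P k > 0)"
  shows "num_pos_roots P \<le> 1"
proof -
  let ?T = "tropical_indices P"
  have T4: "k \<le> 4" if "k \<in> ?T" for k using that assms(2) by (auto simp: tropical_indices_def)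
  define c :: real where "c = (if m = 0 then - 1 else if m = 1 then 1/5
       else if m = 2 then (if 1 \<in> ?T then 6/5 else 1)
       else if m = 3 then (if 2 \<in> ?T then 14/5 else if 1 \<in> ?T then 2 else 1)
       else if 3 \<in> ?T then 19/5 else if 2 \<in> ?T \<or> 1 \<in> ?T then 3 else 2)"
  show ?thesis
  proof (rule num_pos_roots_le_1[of _ c])
    fix x :: real assume x: "x > 0"
    define t where "t k = s * coeff P k * x ^ k" for k
    define z where "z k = (if k \<in> ?T then \<bar>coeff P k\<bar> * x ^ k else 0)" for k
    have z0: "z k \<ge> 0" for k using x by (simp add: z_def)
    have at: "\<bar>t k\<bar> = \<bar>coeff P k\<bar> * x ^ k" for k
      using x assms(3) by (auto simp: t_def abs_mult)
    have inT: "z k > 0 \<and> t k = (if k < m then - z k else z k)" if "k \<in> ?T" for k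
    proof -
      have "z k = \<bar>t k\<bar>" using that by (simp add: z_def at)
      moreover have "if k < m then t k < 0 else t k > 0"
        using bspec[OF assms(5) that] x by (auto simp: t_def mult_less_0_iff split: if_splits)
      ultimately show ?thesis by (auto split: if_splits)
    qed
    have out: "z k = 0 \<and> \<bar>t k\<bar> \<le> (\<Sum>i\<le>4. exp (- ((real i - real k)\<^sup>2)) * z i)" if "k \<notin> ?T" for k
      using hidden_term_bound[OF x that assms(2)] that unfolding at by (simp add: z_def)
    have sum: "(\<Sum>i\<le>4. f i) = f 0 + f 1 + f 2 + f 3 + f 4" for f :: "nat \<Rightarrow> real"
      by (simp add: numeral_eq_Suc)
    note e = mult_right_mono[OF exp_minus_bounds(1) z0] mult_right_mono[OF exp_minus_bounds(2) z0]
      mult_right_mono[OF exp_minus_bounds(3) z0]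
    have 0: "t 0 = 0" if "0 \<notin> ?T" using lowest_index_tropical[OF assms(1), of 0] that
      by (auto simp: t_def)
    have 4: "t 4 = 0" if "4 \<notin> ?T"
    proof -
      have "degree P < 4" using degree_tropical[OF assms(1)] that assms(2)
        by (metis order.not_eq_order_implies_strict)
      then show ?thesis by (simp add: t_def coeff_eq_0)
    qed
    have "- c * t 0 + (1 - c) * t 1 + (2 - c) * t 2 + (3 - c) * t 3 + (4 - c) * t 4 > 0"
    proof (rule weighted_sum_pos[where ?b0.0 = "0 \<in> ?T" and ?b1.0 = "1 \<in> ?T" and ?b2.0 = "2 \<in> ?T"
          and ?b3.0 = "3 \<in> ?T" and ?b4.0 = "4 \<in> ?T" and m = m and
          ?z0.0 = "z 0" and ?z1.0 = "z 1" and ?z2.0 = "z 2" and ?z3.0 = "z 3" and ?z4.0 = "z 4"])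
      show "if 0 \<in> ?T then 0 < z 0 \<and> t 0 = (if 0 < m then - z 0 else z 0) else z 0 = 0 \<and> t 0 = 0"
        using inT[of 0] out[of 0] 0 by auto
      show "if 4 \<in> ?T then 0 < z 4 \<and> t 4 = (if 4 < m then - z 4 else z 4) else z 4 = 0 \<and> t 4 = 0"
        using inT[of 4] out[of 4] 4 by auto
      show "if 1 \<in> ?T then 0 < z 1 \<and> t 1 = (if 1 < m then - z 1 else z 1)
         else z 1 = 0 \<and> \<bar>t 1\<bar> \<le> 3/8 * z 0 + 3/8 * z 2 + 1/50 * z 3 + 1/1000 * z 4"
        using inT[of 1] out[of 1] e(1)[of 0] e(1)[of 2] e(2)[of 3] e(3)[of 4]
        by (auto simp: sum)
      show "if 2 \<in> ?T then 0 < z 2 \<and> t 2 = (if 2 < m then - z 2 else z 2)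
         else z 2 = 0 \<and> \<bar>t 2\<bar> \<le> 1/50 * z 0 + 3/8 * z 1 + 3/8 * z 3 + 1/50 * z 4"
        using inT[of 2] out[of 2] e(2)[of 0] e(1)[of 1] e(1)[of 3] e(2)[of 4]
        by (auto simp: sum)
      show "if 3 \<in> ?T then 0 < z 3 \<and> t 3 = (if 3 < m then - z 3 else z 3)
         else z 3 = 0 \<and> \<bar>t 3\<bar> \<le> 1/1000 * z 0 + 1/50 * z 1 + 3/8 * z 2 + 3/8 * z 4"
        using inT[of 3] out[of 3] e(3)[of 0] e(2)[of 1] e(1)[of 2] e(1)[of 4]
        by (auto simp: sum)
      have le4: "k = 0 \<or> k = 1 \<or> k = 2 \<or> k = 3 \<or> k = 4" if "k \<in> ?T" for k
        using T4[OF that] by arith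
      show "0 \<in> ?T \<or> 1 \<in> ?T \<or> 2 \<in> ?T \<or> 3 \<in> ?T \<or> 4 \<in> ?T"
        using le4[OF degree_tropical] degree_tropical assms(1) by metis
      show "m = 0 \<or> m = 1 \<and> 1 \<in> ?T \<or> m = 2 \<and> 2 \<in> ?T \<or> m = 3 \<and> 3 \<in> ?T \<or> m = 4 \<and> 4 \<in> ?T"
        using assms(4) le4[of m] by auto
    qed (fact c_def)
    also have "\<dots> = s * (x * poly (pderiv P) x - c * poly P x)" (is "?L = _")
    proof -
      define a where "a = coeff P"
      have P: "P = [:a 0, a 1, a 2, a 3, a 4:]"
        unfolding a_def by (rule poly_eq_pCons5[OF assms(2)])
      have "poly (pderiv P) x = a 1 + 2 * a 2 * x + 3 * a 3 * x^2 + 4 * a 4 * x^3"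
        unfolding P by (simp add: pderiv_pCons algebra_simps power2_eq_square power3_eq_cube)
      moreover have "poly P x = a 0 + a 1 * x + a 2 * x^2 + a 3 * x^3 + a 4 * x^4"
        unfolding P by (simp add: algebra_simps power_numeral_reduce)
      ultimately show ?thesis
        unfolding t_def a_def[symmetric] by (simp add: algebra_simps power_numeral_reduce)
    qed
    finally show "x * poly (pderiv P) x - c * poly P x \<noteq> 0" by auto
  qed
qed

section \<open>Polynomials with only positive roots\<close>

text \<open>
  At \<open>x = |a\<^sub>l| / |a\<^sub>k|\<close> with \<open>k = l + 1\<close>, the terms of index \<open>l\<close> and \<open>k\<close> are equal, and by log-concavity
  they are the largest ones. This contradicts \<open>tropical_domination\<close> unless \<open>k\<close> is a tropical
  index, since a term of index \<open>i \<noteq> k\<close> enters with a factor less than \<open>1\<close>.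
\<close>

lemma log_concave_tropical:
  assumes "P \<noteq> 0" "\<And>i. i \<le> degree P \<Longrightarrow> coeff P i \<noteq> 0"
    and lc: "\<And>i. Suc (Suc i) \<le> degree P \<Longrightarrow>
       \<bar>coeff P i\<bar> * \<bar>coeff P (Suc (Suc i))\<bar> \<le> \<bar>coeff P (Suc i)\<bar> * \<bar>coeff P (Suc i)\<bar>"
    and "k \<le> degree P"
  shows "k \<in> tropical_indices P"
proof (cases k)
  case 0
  then show ?thesis using lowest_index_tropical[OF assms(1), of 0] assms(2)[of 0] by simp
next
  case k: (Suc l)
  define x where "x = \<bar>coeff P l\<bar> / \<bar>coeff P k\<bar>"
  have x: "x > 0" unfolding x_def using assms(2)[of l] assms(2)[of k] assms(4) k by simp
  define t where "t j = \<bar>coeff P j\<bar> * x ^ j" for j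
  have tpos: "t j > 0" if "j \<le> degree P" for j
    using assms(2)[OF that] x by (simp add: t_def)
  have tlk: "t l = t k"
    using assms(2)[of k] assms(4) unfolding t_def k by (simp add: x_def k)
  have tlc: "t j * t (Suc (Suc j)) \<le> t (Suc j) * t (Suc j)" if "Suc (Suc j) \<le> degree P" for j
  proof -
    have "(x ^ j * x ^ j * x * x) * (\<bar>coeff P j\<bar> * \<bar>coeff P (Suc (Suc j))\<bar>)
       \<le> (x ^ j * x ^ j * x * x) * (\<bar>coeff P (Suc j)\<bar> * \<bar>coeff P (Suc j)\<bar>)"
      using lc[OF that] x by (intro mult_left_mono) auto
    then show ?thesis by (simp add: t_def mult_ac)
  qed
  have up: "l + Suc j \<le> degree P \<Longrightarrow> t (l + Suc j) \<le> t (l + j)" for j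
  proof (induction j)
    case 0
    then show ?case using tlk k by simp
  next
    case (Suc j)
    have "t (l + j) * t (l + Suc (Suc j)) \<le> t (l + Suc j) * t (l + Suc j)"
      using tlc[of "l + j"] Suc.prems by simp
    also have "\<dots> \<le> t (l + j) * t (l + Suc j)"
      using Suc tpos[of "l + Suc j"] by (intro mult_right_mono) auto
    finally show ?case using tpos[of "l + j"] Suc.prems by simp
  qed
  have up': "t (l + j) \<le> t k" if "l + j \<le> degree P" for j
    using that by (induction j) (use up tlk in \<open>auto intro: order_trans\<close>)
  have down: "j \<le> l \<Longrightarrow> t j \<le> t (Suc j)" for j
  proof (induction j rule: inc_induct)
    case base
    then show ?case using tlk k by simp
  next
    case (step j)
    have sd: "Suc (Suc j) \<le> degree P" using step assms(4) k by simp
    have "t j * t (Suc (Suc j)) \<le> t (Suc j) * t (Suc j)" using tlc[OF sd] .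
    also have "\<dots> \<le> t (Suc j) * t (Suc (Suc j))"
      using step tpos[of "Suc j"] sd by (intro mult_left_mono) auto
    finally show ?case using tpos[OF sd] by simp
  qed
  have down': "j \<le> l \<Longrightarrow> t j \<le> t k" for j
  proof (induction j rule: inc_induct)
    case (step j)
    then show ?case using down[of j] by simp
  qed (simp add: tlk)
  have le: "t j \<le> t k" if "j \<le> degree P" for j
    using down'[of j] up'[of "j - l"] that by (cases "j \<le> l") auto
  show ?thesis
  proof (rule ccontr)
    assume kT: "k \<notin> tropical_indices P"
    obtain i where i: "i \<in> tropical_indices P" "t k \<le> exp (- ((real i - real k)\<^sup>2)) * t i"
      using tropical_domination[OF x, of P k] unfolding t_def by blast
    then have id: "i \<le> degree P" by (simp add: tropical_indices_def)
    have "i \<noteq> k" using i(1) kT by blast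
    then have "exp (- ((real i - real k)\<^sup>2)) * t i < 1 * t i"
      using tpos[OF id] by (intro mult_strict_right_mono) auto
    with i(2) le[OF id] show False by simp
  qed
qed

lemma num_pos_essential_roots_eq_4:
  assumes "degree P \<le> 4" "num_pos_roots P = 4"
  shows "num_pos_essential_roots P = 4"
proof -
  obtain r1 Q1 where 1: "r1 > 0" "P = [:- r1, 1:] * Q1" "Q1 \<noteq> 0"
    using num_pos_roots_gt_0D[of P] assms by auto
  have N1: "num_pos_roots Q1 = 3" using num_pos_roots_linear_factor[OF 1(3), of r1] 1 assms by simp
  obtain r2 Q2 where 2: "r2 > 0" "Q1 = [:- r2, 1:] * Q2" "Q2 \<noteq> 0"
    using num_pos_roots_gt_0D[of Q1] N1 by auto
  have N2: "num_pos_roots Q2 = 2" using num_pos_roots_linear_factor[OF 2(3), of r2] 2 N1 by simp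
  obtain r3 Q3 where 3: "r3 > 0" "Q2 = [:- r3, 1:] * Q3" "Q3 \<noteq> 0"
    using num_pos_roots_gt_0D[of Q2] N2 by auto
  have N3: "num_pos_roots Q3 = 1" using num_pos_roots_linear_factor[OF 3(3), of r3] 3 N2 by simp
  obtain r4 Q4 where 4: "r4 > 0" "Q3 = [:- r4, 1:] * Q4" "Q4 \<noteq> 0"
    using num_pos_roots_gt_0D[of Q3] N3 by auto
  have dP: "degree P = 4 + degree Q4"
    unfolding 1(2) 2(2) 3(2) 4(2) using 4(3) by (simp add: degree_mult_eq del: mult_pCons_left)
  then have "degree Q4 = 0" using assms(1) by simp
  then obtain c where c: "Q4 = [:c:]" by (rule degree_eq_zeroE)
  have c0: "c \<noteq> 0" using c 4(3) by auto
  define e1 where "e1 = r1 + r2 + r3 + r4"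
  define e2 where "e2 = r1*r2 + r1*r3 + r1*r4 + r2*r3 + r2*r4 + r3*r4"
  define e3 where "e3 = r1*r2*r3 + r1*r2*r4 + r1*r3*r4 + r2*r3*r4"
  define e4 where "e4 = r1*r2*r3*r4"
  note e_defs = e1_def e2_def e3_def e4_def
  have P: "P = smult c [:e4, - e3, e2, - e1, 1:]"
    unfolding 1(2) 2(2) 3(2) 4(2) c by (simp add: e_defs algebra_simps)
  have pos: "e1 > 0" "e2 > 0" "e3 > 0" "e4 > 0"
    using 1(1) 2(1) 3(1) 4(1) unfolding e_defs
    by (auto intro!: add_pos_pos mult_pos_pos)
  \<comment> \<open>each difference is a polynomial in the roots with nonnegative coefficients\<close>
  have "e1 * e1 - e2 = r1^2 + r2^2 + r3^2 + r4^2 + e2"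
    unfolding e_defs by algebra
  also have "\<dots> \<ge> 0" using pos by simp
  finally have l3: "e2 \<le> e1 * e1" by simp
  have "e2 * e2 - e1 * e3 = (r1*r2)^2 + (r1*r3)^2 + (r1*r4)^2 + (r2*r3)^2 + (r2*r4)^2 + (r3*r4)^2
      + (r1^2 * (r2*r3 + r2*r4 + r3*r4) + r2^2 * (r1*r3 + r1*r4 + r3*r4)
      + r3^2 * (r1*r2 + r1*r4 + r2*r4) + r4^2 * (r1*r2 + r1*r3 + r2*r3)) + 2 * e4"
    unfolding e_defs by algebra
  also have "\<dots> \<ge> 0" using pos 1(1) 2(1) 3(1) 4(1)
    by (intro add_nonneg_nonneg mult_nonneg_nonneg) auto
  finally have l2: "e1 * e3 \<le> e2 * e2" by simp
  have "e3 * e3 - e2 * e4 = (r1*r2*r3)^2 + (r1*r2*r4)^2 + (r1*r3*r4)^2 + (r2*r3*r4)^2 + e2 * e4"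
    unfolding e_defs by algebra
  also have "\<dots> \<ge> 0" using pos by simp
  finally have l1: "e2 * e4 \<le> e3 * e3" by simp
  have co: "coeff P 0 = c * e4" "coeff P 1 = - (c * e3)" "coeff P 2 = c * e2"
    "coeff P 3 = - (c * e1)" "coeff P 4 = c"
    unfolding P by (simp_all add: numeral_eq_Suc)
  have d4: "degree P = 4" using dP c by simp
  have cases4: "i = 0 \<or> i = 1 \<or> i = 2 \<or> i = 3 \<or> i = 4" if "i \<le> 4" for i :: nat
    using that by arith
  have "k \<in> tropical_indices P" if "k \<le> 4" for k
  proof (rule log_concave_tropical)
    show "P \<noteq> 0" using c0 co(5) by auto
    show "k \<le> degree P" using that d4 by simp
    show "coeff P i \<noteq> 0" if "i \<le> degree P" for i
      using cases4[of i] that pos c0 co unfolding d4 by auto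
    fix i assume "Suc (Suc i) \<le> degree P"
    then have "i = 0 \<or> i = 1 \<or> i = 2" unfolding d4 by arith
    moreover have "\<bar>c * u\<bar> * \<bar>c * w\<bar> \<le> \<bar>c * v\<bar> * \<bar>c * v\<bar>"
      if "u > 0" "v > 0" "w > 0" "u * w \<le> v * v" for u v w
    proof -
      have "(\<bar>c\<bar> * \<bar>c\<bar>) * (u * w) \<le> (\<bar>c\<bar> * \<bar>c\<bar>) * (v * v)"
        using that by (intro mult_left_mono) auto
      then show ?thesis using that by (simp add: abs_mult mult_ac)
    qed
    note * = this[of e4 e3 e2] this[of e3 e2 e1] this[of e2 e1 1]
    ultimately show "\<bar>coeff P i\<bar> * \<bar>coeff P (Suc (Suc i))\<bar> \<le> \<bar>coeff P (Suc i)\<bar> * \<bar>coeff P (Suc i)\<bar>"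
      using * pos l1 l2 l3 co by (elim disjE) (simp_all add: numeral_eq_Suc mult.commute)
  qed
  moreover have "k \<le> 4" if "k \<in> tropical_indices P" for k
    using that d4 by (simp add: tropical_indices_def)
  ultimately have "tropical_indices P = {..4}" by blast
  also have "\<dots> = set [0, 1, 2, 3, 4]" using cases4 by auto
  finally have "tropical_indices P = set [0, 1, 2, 3, 4]" .
  then have "sorted_list_of_set (tropical_indices P) = [0, 1, 2, 3, 4]"
    by (simp only: sorted_list_of_set_sort_remdups) simp
  then show ?thesis
    unfolding num_pos_essential_roots_def using co pos c0
    by (simp add: sign_alternations_Cons_Cons mult_less_0_iff sgn_mult)
qed

section \<open>Comparing roots and essential tropical roots\<close>

lemma num_pos_roots_le_essential:
  assumes "P \<noteq> 0" "degree P \<le> 4"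
  shows "num_pos_roots P \<le> num_pos_essential_roots P"
proof (rule ccontr)
  assume "\<not> ?thesis"
  then have lt: "num_pos_essential_roots P < num_pos_roots P" by simp
  have par: "even (num_pos_roots P + num_pos_essential_roots P)"
    using essential_roots_parity[OF assms(1)] .
  have N4: "num_pos_roots P \<le> 4" using num_pos_roots_le_degree[of P] assms(2) by simp
  show False
  proof (cases "num_pos_essential_roots P \<le> 1")
    case True
    then obtain s m where "s \<in> {- 1, 1::real}" "m = 0 \<or> m \<in> tropical_indices P"
      "\<forall>k\<in>tropical_indices P. (if k < m then s * coeff P k < 0 else s * coeff P k > 0)"
      using sign_alternations_le_1_threshold[of "coeff P" "sorted_list_of_set (tropical_indices P)"]
        tropical_index_nonzero[OF assms(1)] finite_tropical_indices[of P]
      unfolding num_pos_essential_roots_def by auto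
    then have "num_pos_roots P \<le> 1"
      using num_pos_roots_le_1_if_threshold[OF assms] by blast
    with lt have "num_pos_roots P + num_pos_essential_roots P = 1" by linarith
    with par show False by simp
  next
    case False
    have "num_pos_roots P = 4"
    proof (rule ccontr)
      assume "num_pos_roots P \<noteq> 4"
      with lt N4 False have "num_pos_roots P + num_pos_essential_roots P = 5" by linarith
      with par show False by simp
    qed
    with num_pos_essential_roots_eq_4[OF assms(2)] lt show False by simp
  qed
qed

lemma coeff_pcompose_uminus:
  "coeff (pcompose P [:0, - 1:]) k = (- 1) ^ k * coeff (P :: 'a :: comm_ring_1 poly) k"
proof (induction P arbitrary: k)
  case (pCons a P)
  then show ?case by (cases k) (auto simp: pcompose_pCons)
qed simp

theorem proposition13:
  fixes P :: "real poly"
  assumes "P \<noteq> 0" and "degree P \<le> 4"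
  shows "num_pos_roots P \<le> num_pos_essential_roots P \<and>
         num_neg_roots P \<le> num_neg_essential_roots P"
proof
  show "num_pos_roots P \<le> num_pos_essential_roots P"
    using num_pos_roots_le_essential[OF assms] .
  define R where "R = pcompose P [:0, - 1:]"
  have dR: "degree R = degree P" unfolding R_def by (simp add: degree_pcompose)
  have "R \<noteq> 0" unfolding R_def using assms(1) by (simp add: pcompose_eq_0_iff)
  have "tropical_indices R = tropical_indices P"
    unfolding tropical_indices_def dR by (simp add: R_def coeff_pcompose_uminus abs_mult)
  then have "num_pos_essential_roots R = num_neg_essential_roots P"
    unfolding num_pos_essential_roots_def num_neg_essential_roots_def
    by (simp add: R_def coeff_pcompose_uminus)
  moreover have "num_neg_roots P \<le> num_pos_roots R"
    unfolding R_def by (rule num_neg_roots_le_reflect)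
  moreover have "num_pos_roots R \<le> num_pos_essential_roots R"
    using num_pos_roots_le_essential \<open>R \<noteq> 0\<close> dR assms(2) by simp
  ultimately show "num_neg_roots P \<le> num_neg_essential_roots P" by simp
qed

end
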